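(* There exists a $2$-connected Eulerian loopless odd-$K_5$-minor-free graph $G$ with an even number of edges which is not even-cycle decomposable; that is, $E(G)$ cannot be partitioned into (the edge sets of) cycles of even length.
   Context: Graphs are finite and may have parallel edges (a pair of parallel edges forms a cycle of length $2$). A graph is Eulerian if all its vertices have even degree (connectivity here follows from $2$-connectedness). A signed graph is a pair $(G,\Sigma)$ where $G$ is a graph and $\Sigma\subseteq E(G)$; edges in $\Sigma$ are negative, the other edges are positive. For $X\subseteq V(G)$, $\delta_G(X)$ denotes the set of edges with exactly one end in $X$, and is called a cut. Re-signing $(G,\Sigma)$ means replacing $\Sigma$ by a signature $\Sigma'$ such that the symmetric difference of $\Sigma$ and $\Sigma'$ is a cut of $G$. A minor of a signed graph is a signed graph obtained from it by any sequence of the following operations: re-signing, deleting edges or vertices, and contracting positive edges. For a graph $H$, odd-$H$ is the signed graph $(H,E(H))$. A signed graph is odd-$H$-minor-free if it has no minor isomorphic to odd-$H$. A graph $G$ is odd-$H$-minor-free if the signed graph $(G,E(G))$ is odd-$H$-minor-free. *)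

theory Defs
  imports Main "HOL-Library.Disjoint_Sets"
begin

text \<open>
  Undirected multigraphs. \<open>ends e\<close> is the set of end vertices of the edge \<open>e\<close>; it is a
  singleton exactly when \<open>e\<close> is a loop. Loops have to be admitted because contracting one of
  two parallel edges turns the other into a loop. The value of \<open>ends\<close> outside \<open>edges\<close> is
  irrelevant.
\<close>

record ('v, 'e) mgraph =
  verts :: "'v set"
  edges :: "'e set"
  ends :: "'e \<Rightarrow> 'v set"

definition fin_mgraph :: "('v, 'e) mgraph \<Rightarrow> bool" where
  "fin_mgraph G \<longleftrightarrow> finite (verts G) \<and> finite (edges G) \<and>
     (\<forall>e\<in>edges G. \<exists>u\<in>verts G. \<exists>v\<in>verts G. ends G e = {u, v})"

definition loopless :: "('v, 'e) mgraph \<Rightarrow> bool" where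
  "loopless G \<longleftrightarrow> (\<forall>e\<in>edges G. \<nexists>v. ends G e = {v})"

text \<open>A loop contributes two to the degree of its end.\<close>

definition degree :: "('v, 'e) mgraph \<Rightarrow> 'v \<Rightarrow> nat" where
  "degree G v = card {e \<in> edges G. v \<in> ends G e} + card {e \<in> edges G. ends G e = {v}}"

definition eulerian :: "('v, 'e) mgraph \<Rightarrow> bool" where
  "eulerian G \<longleftrightarrow> (\<forall>v\<in>verts G. even (degree G v))"

definition adjacent :: "('v, 'e) mgraph \<Rightarrow> 'v \<Rightarrow> 'v \<Rightarrow> bool" where
  "adjacent G u v \<longleftrightarrow> (\<exists>e\<in>edges G. ends G e = {u, v})"

definition connected :: "('v, 'e) mgraph \<Rightarrow> bool" where
  "connected G \<longleftrightarrow> verts G \<noteq> {} \<and> (\<forall>u\<in>verts G. \<forall>v\<in>verts G. (adjacent G)\<^sup>*\<^sup>* u v)"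

definition delete_vertices :: "('v, 'e) mgraph \<Rightarrow> 'v set \<Rightarrow> ('v, 'e) mgraph" where
  "delete_vertices G X =
     \<lparr>verts = verts G - X, edges = {e \<in> edges G. ends G e \<inter> X = {}}, ends = ends G\<rparr>"

definition k_connected :: "nat \<Rightarrow> ('v, 'e) mgraph \<Rightarrow> bool" where
  "k_connected k G \<longleftrightarrow> k < card (verts G) \<and>
     (\<forall>X\<subseteq>verts G. card X < k \<longrightarrow> connected (delete_vertices G X))"

text \<open>
  \<open>C\<close> is the edge set of a cycle that visits distinct vertices \<open>vs\<close> along distinct edges
  \<open>es\<close>. A loop is a cycle of length 1 and two parallel edges form a cycle of length 2. The
  length of the cycle is \<open>card C\<close>.
\<close>

definition cycle_edges :: "('v, 'e) mgraph \<Rightarrow> 'e set \<Rightarrow> bool" where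
  "cycle_edges G C \<longleftrightarrow> C \<subseteq> edges G \<and>
     (\<exists>vs es. es \<noteq> [] \<and> length vs = length es \<and> distinct vs \<and> distinct es \<and> set es = C \<and>
        (\<forall>i<length es. ends G (es ! i) = {vs ! i, vs ! (Suc i mod length vs)}))"

definition even_cycle_decomposable :: "('v, 'e) mgraph \<Rightarrow> bool" where
  "even_cycle_decomposable G \<longleftrightarrow>
     (\<exists>P. partition_on (edges G) P \<and> (\<forall>C\<in>P. cycle_edges G C \<and> even (card C)))"

text \<open>
  A signed graph is a pair \<open>(G, S)\<close> with \<open>S \<subseteq> edges G\<close>, where \<open>S\<close> is the set of negative
  edges.
\<close>

type_synonym ('v, 'e) sgraph = "('v, 'e) mgraph \<times> 'e set"

definition cut :: "('v, 'e) mgraph \<Rightarrow> 'v set \<Rightarrow> 'e set" where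
  "cut G X = {e \<in> edges G. \<exists>u v. ends G e = {u, v} \<and> u \<in> X \<and> v \<notin> X}"

definition delete_edge :: "('v, 'e) mgraph \<Rightarrow> 'e \<Rightarrow> ('v, 'e) mgraph" where
  "delete_edge G e = G\<lparr>edges := edges G - {e}\<rparr>"

text \<open>
  Contraction of an edge \<open>e\<close> with ends \<open>u\<close> and \<open>v\<close>; the merged vertex keeps the name \<open>u\<close>.
  Edges parallel to \<open>e\<close> become loops, and contracting a loop (\<open>u = v\<close>) deletes it.
\<close>

definition contract_edge ::
    "('v, 'e) mgraph \<Rightarrow> 'e \<Rightarrow> 'v \<Rightarrow> 'v \<Rightarrow> ('v, 'e) mgraph" where
  "contract_edge G e u v =
     (let f = (\<lambda>x. if x = v then u else x)
      in \<lparr>verts = f ` verts G, edges = edges G - {e}, ends = (\<lambda>e'. f ` ends G e')\<rparr>)"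

inductive minor_step :: "('v, 'e) sgraph \<Rightarrow> ('v, 'e) sgraph \<Rightarrow> bool" where
  resign: "\<lbrakk>X \<subseteq> verts G; S' \<subseteq> edges G; sym_diff S S' = cut G X\<rbrakk>
    \<Longrightarrow> minor_step (G, S) (G, S')"
| delete_edge: "e \<in> edges G \<Longrightarrow> minor_step (G, S) (delete_edge G e, S - {e})"
| delete_vertex: "\<lbrakk>v \<in> verts G; G' = delete_vertices G {v}\<rbrakk>
    \<Longrightarrow> minor_step (G, S) (G', S \<inter> edges G')"
| contract: "\<lbrakk>e \<in> edges G; e \<notin> S; ends G e = {u, v}\<rbrakk>
    \<Longrightarrow> minor_step (G, S) (contract_edge G e u v, S)"

text \<open>\<open>sgraph_minor M N\<close>: the signed graph \<open>N\<close> is a minor of \<open>M\<close>.\<close>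

definition sgraph_minor :: "('v, 'e) sgraph \<Rightarrow> ('v, 'e) sgraph \<Rightarrow> bool" where
  "sgraph_minor = minor_step\<^sup>*\<^sup>*"

definition sgraph_iso :: "('v, 'e) sgraph \<Rightarrow> ('w, 'f) sgraph \<Rightarrow> bool" where
  "sgraph_iso M N \<longleftrightarrow> (\<exists>f g.
     bij_betw f (verts (fst M)) (verts (fst N)) \<and>
     bij_betw g (edges (fst M)) (edges (fst N)) \<and>
     (\<forall>e\<in>edges (fst M). ends (fst N) (g e) = f ` ends (fst M) e) \<and>
     g ` snd M = snd N)"

definition odd_sgraph :: "('v, 'e) mgraph \<Rightarrow> ('v, 'e) sgraph" where
  "odd_sgraph H = (H, edges H)"

definition sgraph_odd_minor_free :: "('w, 'f) mgraph \<Rightarrow> ('v, 'e) sgraph \<Rightarrow> bool" where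
  "sgraph_odd_minor_free H M \<longleftrightarrow>
     \<not> (\<exists>N. sgraph_minor M N \<and> sgraph_iso N (odd_sgraph H))"

definition odd_minor_free :: "('w, 'f) mgraph \<Rightarrow> ('v, 'e) mgraph \<Rightarrow> bool" where
  "odd_minor_free H G \<longleftrightarrow> sgraph_odd_minor_free H (G, edges G)"

definition complete_graph :: "nat \<Rightarrow> (nat, nat set) mgraph" where
  "complete_graph n = \<lparr>verts = {..<n}, edges = {e. e \<subseteq> {..<n} \<and> card e = 2}, ends = id\<rparr>"

end

theory Submission
  imports Defs
begin

text \<open>
  Double each spoke of the Petersen graph, subdivide one edge of each doubled spoke, and subdivide
  one edge of the outer 5-cycle. The two parallel routes along a spoke have different parity and
  form a triangle, so in an even cycle decomposition they belong to different cycles, and each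
  of these two cycles continues along an outer and along an inner edge. The resulting equalities
  between the cycles on outer and inner edges are contradictory; equivalently, the Petersen graph
  has no faithful cycle cover with weight 2 on the spokes and 1 on the other edges.

  An odd-\<open>K\<^sub>5\<close>-minor yields five disjoint connected branch sets that are pairwise joined by
  negative edges after switching. Vertices of degree two can be suppressed, which leaves
  the Petersen graph with spokes of both signs. As it is cubic with ten vertices, the branch sets
  are the edges of a perfect matching, and this matching uses 0 or 2 edges of the outer 5-cycle.
  By the girth, every other outer edge is the only connection between its branch sets. So after
  switching the outer 5-cycle has 5 or 3 negative edges, but it has an even number of them.
\<close>

section \<open>Branch set models of odd complete graphs\<close>

text \<open>\<open>b\<close> is true for negative edges. Models only ask whether an edge of a given
  sign exists, so the multigraph is replaced by this relation; parallel edges of opposite signs make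
  it hold for both values.\<close>

definition sadj :: "('v, 'e) sgraph \<Rightarrow> 'v \<Rightarrow> 'v \<Rightarrow> bool \<Rightarrow> bool" where
  "sadj M u v b \<longleftrightarrow> (\<exists>e\<in>edges (fst M). ends (fst M) e = {u, v} \<and> b = (e \<in> snd M))"

text \<open>
  The vertices with \<open>cl v = i < n\<close> form the \<open>i\<close>-th branch set and those with \<open>cl v \<ge> n\<close> are unused.
  Re-signing along the cut of \<open>{v. \<sigma> v}\<close> flips the sign of an edge \<open>uv\<close> if and only if
  \<open>\<sigma> u \<noteq> \<sigma> v\<close>, so afterwards the edges with sign \<open>\<sigma> u \<noteq> \<sigma> v\<close> are positive.
\<close>

definition pos :: "('v \<Rightarrow> 'v \<Rightarrow> bool \<Rightarrow> bool) \<Rightarrow> ('v \<Rightarrow> nat) \<Rightarrow> ('v \<Rightarrow> bool) \<Rightarrow> 'v \<Rightarrow> 'v \<Rightarrow> bool" where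
  "pos A cl \<sigma> u v \<longleftrightarrow> cl u = cl v \<and> A u v (\<sigma> u \<noteq> \<sigma> v)"

definition odd_model ::
    "'v set \<Rightarrow> ('v \<Rightarrow> 'v \<Rightarrow> bool \<Rightarrow> bool) \<Rightarrow> nat \<Rightarrow> ('v \<Rightarrow> nat) \<Rightarrow> ('v \<Rightarrow> bool) \<Rightarrow> bool" where
  "odd_model V A n cl \<sigma> \<longleftrightarrow>
     (\<forall>i<n. \<exists>v\<in>V. cl v = i) \<and>
     (\<forall>u\<in>V. \<forall>v\<in>V. cl u = cl v \<longrightarrow> cl u < n \<longrightarrow> (pos A cl \<sigma>)\<^sup>*\<^sup>* u v) \<and>
     (\<forall>i<n. \<forall>j<n. i \<noteq> j \<longrightarrow> (\<exists>u\<in>V. \<exists>v\<in>V. cl u = i \<and> cl v = j \<and> A u v (\<sigma> u = \<sigma> v)))"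

lemma odd_modelD:
  assumes "odd_model V A n cl \<sigma>"
  shows "i < n \<Longrightarrow> \<exists>v\<in>V. cl v = i"
    and "u \<in> V \<Longrightarrow> v \<in> V \<Longrightarrow> cl u = cl v \<Longrightarrow> cl u < n \<Longrightarrow> (pos A cl \<sigma>)\<^sup>*\<^sup>* u v"
    and "i < n \<Longrightarrow> j < n \<Longrightarrow> i \<noteq> j \<Longrightarrow> \<exists>u\<in>V. \<exists>v\<in>V. cl u = i \<and> cl v = j \<and> A u v (\<sigma> u = \<sigma> v)"
  using assms unfolding odd_model_def by blast+

section \<open>Pulling models back along minor operations\<close>

lemma odd_model_mono:
  assumes m: "odd_model V A n cl \<sigma>"
    and A: "\<And>u v. A u v (\<sigma> u \<noteq> \<sigma> v) \<Longrightarrow> A' u v (\<sigma>' u \<noteq> \<sigma>' v)"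
      "\<And>u v. A u v (\<sigma> u = \<sigma> v) \<Longrightarrow> A' u v (\<sigma>' u = \<sigma>' v)"
  shows "odd_model V A' n cl \<sigma>'"
proof -
  have "pos A cl \<sigma> \<le> pos A' cl \<sigma>'"
    unfolding pos_def using A(1) by blast
  then have "(pos A cl \<sigma>)\<^sup>*\<^sup>* \<le> (pos A' cl \<sigma>')\<^sup>*\<^sup>*"
    by (rule rtranclp_mono)
  then have "(pos A' cl \<sigma>')\<^sup>*\<^sup>* u v" if "u \<in> V" "v \<in> V" "cl u = cl v" "cl u < n" for u v
    using odd_modelD(2)[OF m that] by blast
  moreover have "\<exists>u\<in>V. \<exists>v\<in>V. cl u = i \<and> cl v = j \<and> A' u v (\<sigma>' u = \<sigma>' v)"
    if "i < n" "j < n" "i \<noteq> j" for i j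
    using odd_modelD(3)[OF m that] A(2) by blast
  ultimately show ?thesis
    using odd_modelD(1)[OF m] unfolding odd_model_def by simp
qed

text \<open>An edge changes sign exactly when it crosses \<open>Y\<close>. Adding membership in
  \<open>Y\<close> modulo 2 to the switching function compensates for this, so every edge keeps its
  switched sign.\<close>

lemma odd_model_resign:
  assumes m: "odd_model (verts G) (sadj (G, S')) n cl \<sigma>" and S: "sym_diff S S' = cut G Y"
  shows "odd_model (verts G) (sadj (G, S)) n cl (\<lambda>u. \<sigma> u \<noteq> (u \<in> Y))"
proof -
  have "e \<in> cut G Y \<longleftrightarrow> (u \<in> Y) \<noteq> (v \<in> Y)" if "e \<in> edges G" "ends G e = {u, v}" for e u v
    using that unfolding cut_def by (auto simp: doubleton_eq_iff)
  then have "e \<in> S' \<longleftrightarrow> ((e \<in> S) \<noteq> ((u \<in> Y) \<noteq> (v \<in> Y)))"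
    if "e \<in> edges G" "ends G e = {u, v}" for e u v
    using that S by blast
  note S'_iff = this
  have A: "sadj (G, S) u v b'"
    if adj: "sadj (G, S') u v b" and b': "b' = (b \<noteq> ((u \<in> Y) \<noteq> (v \<in> Y)))" for u v b b'
  proof -
    obtain e where e: "e \<in> edges G" "ends G e = {u, v}" "b = (e \<in> S')"
      using adj unfolding sadj_def by auto
    have "b' = (e \<in> S)"
      using S'_iff[OF e(1,2)] b' e(3) by argo
    then show ?thesis
      using e unfolding sadj_def by auto
  qed
  show ?thesis
    by (rule odd_model_mono[OF m]; erule A) auto
qed

lemma odd_model_delete_vertex:
  assumes m: "odd_model (verts G') (sadj (G', S \<inter> edges G')) n cl \<sigma>"
    and G': "G' = delete_vertices G {x}"
  shows "odd_model (verts G) (sadj (G, S)) n (cl(x := n)) \<sigma>"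
proof -
  have A: "sadj (G, S) u v b \<and> u \<noteq> x \<and> v \<noteq> x" if "sadj (G', S \<inter> edges G') u v b" for u v b
    using that unfolding sadj_def G' delete_vertices_def by auto
  have V: "verts G' = verts G - {x}"
    by (simp add: G' delete_vertices_def)
  have "pos (sadj (G', S \<inter> edges G')) cl \<sigma> \<le> pos (sadj (G, S)) (cl(x := n)) \<sigma>"
    unfolding pos_def using A by auto
  then have P: "(pos (sadj (G', S \<inter> edges G')) cl \<sigma>)\<^sup>*\<^sup>* \<le> (pos (sadj (G, S)) (cl(x := n)) \<sigma>)\<^sup>*\<^sup>*"
    by (rule rtranclp_mono)
  show ?thesis
    unfolding odd_model_def
  proof (intro conjI allI impI ballI)
    fix i assume "i < n"
    then show "\<exists>v\<in>verts G. (cl(x := n)) v = i"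
      using odd_modelD(1)[OF m] V by fastforce
  next
    fix u v assume "u \<in> verts G" "v \<in> verts G" "(cl(x := n)) u = (cl(x := n)) v" "(cl(x := n)) u < n"
    then have "u \<in> verts G'" "v \<in> verts G'" "cl u = cl v" "cl u < n"
      using V by (auto split: if_splits)
    then show "(pos (sadj (G, S)) (cl(x := n)) \<sigma>)\<^sup>*\<^sup>* u v"
      using odd_modelD(2)[OF m] P by blast
  next
    fix i j assume "i < n" "j < n" "i \<noteq> j"
    then obtain u v where "u \<in> verts G'" "v \<in> verts G'" "cl u = i" "cl v = j"
        "sadj (G', S \<inter> edges G') u v (\<sigma> u = \<sigma> v)"
      using odd_modelD(3)[OF m] by blast
    moreover from this have "sadj (G, S) u v (\<sigma> u = \<sigma> v)" "u \<noteq> x" "v \<noteq> x"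
      using A by blast+
    ultimately show "\<exists>u\<in>verts G. \<exists>v\<in>verts G. (cl(x := n)) u = i \<and> (cl(x := n)) v = j
        \<and> sadj (G, S) u v (\<sigma> u = \<sigma> v)"
      unfolding V by (intro bexI[of _ u] bexI[of _ v]) simp_all
  qed
qed

lemma image_doubletonE:
  assumes "f ` E = {a, b}" "\<exists>p q. E = {p, q}"
  obtains p q where "E = {p, q}" "f p = a" "f q = b"
proof -
  obtain p q where E: "E = {p, q}"
    using assms(2) by blast
  then have "f p = a \<and> f q = b \<or> f p = b \<and> f q = a"
    using assms(1) by (simp add: doubleton_eq_iff)
  then show thesis
    using E that[of p q] that[of q p] by (auto simp: insert_commute)
qed

text \<open>The model is pulled back along the contraction map \<open>f\<close>. Branch sets stay
  connected because \<open>u\<close> and \<open>v\<close> are joined by \<open>e\<close>, which is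
  positive and stays so after switching, as \<open>\<sigma> \<circ> f\<close> agrees on
  \<open>u\<close> and \<open>v\<close>.\<close>

lemma odd_model_contract:
  assumes m: "odd_model (verts G') (sadj (G', S)) n cl \<sigma>"
    and G': "G' = contract_edge G e u v"
    and e: "e \<in> edges G" "e \<notin> S" "ends G e = {u, v}"
    and fin: "fin_mgraph G"
  shows "\<exists>cl \<sigma>. odd_model (verts G) (sadj (G, S)) n cl \<sigma>"
proof -
  define f where "f = (\<lambda>x. if x = v then u else x)"
  have G'f: "verts G' = f ` verts G" "edges G' = edges G - {e}" "ends G' = (\<lambda>e'. f ` ends G e')"
    by (simp_all add: G' contract_edge_def f_def)
  have lift: "\<exists>p q. f p = a \<and> f q = b \<and> p \<in> verts G \<and> q \<in> verts G \<and> sadj (G, S) p q c"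
    if "sadj (G', S) a b c" for a b c
  proof -
    from that obtain e' where e': "e' \<in> edges G" "f ` ends G e' = {a, b}" "c = (e' \<in> S)"
      unfolding sadj_def fst_conv snd_conv G'f by blast
    have "\<exists>p q. ends G e' = {p, q}"
      using e'(1) fin unfolding fin_mgraph_def by blast
    then obtain p q where pq: "ends G e' = {p, q}" "f p = a" "f q = b"
      by (rule image_doubletonE[OF e'(2)])
    moreover have "p \<in> verts G" "q \<in> verts G"
      using fin e'(1) pq(1) unfolding fin_mgraph_def by fastforce+
    ultimately show ?thesis
      using e' unfolding sadj_def by auto
  qed
  let ?R = "pos (sadj (G, S)) (cl \<circ> f) (\<sigma> \<circ> f)"
  have same: "?R\<^sup>*\<^sup>* x y" if "f x = f y" for x y
  proof (cases "x = y")
    case False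
    then have "{x, y} = {u, v}"
      using that unfolding f_def by (auto split: if_splits)
    moreover have "f u = f v" by (simp add: f_def)
    ultimately have "?R x y"
      using e that unfolding pos_def sadj_def by auto
    then show ?thesis ..
  qed auto
  \<comment> \<open>Lifts of consecutive edges need not share an end, but their facing ends have the
    same image under \<open>f\<close>, so \<open>same\<close> bridges the gap.\<close>
  have path: "?R\<^sup>*\<^sup>* x y" if "(pos (sadj (G', S)) cl \<sigma>)\<^sup>*\<^sup>* a b" "f x = a" "f y = b" for a b x y
    using that
  proof (induction arbitrary: y rule: rtranclp_induct)
    case base
    then show ?case by (intro same) simp
  next
    case (step b c)
    then obtain p q where "f p = b" "f q = c" "sadj (G, S) p q (\<sigma> b \<noteq> \<sigma> c)" "cl b = cl c"
      unfolding pos_def using lift by metis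
    then have "?R p q" unfolding pos_def by auto
    moreover have "?R\<^sup>*\<^sup>* x p" using step \<open>f p = b\<close> by blast
    moreover have "?R\<^sup>*\<^sup>* q y" using step.prems \<open>f q = c\<close> by (intro same) simp
    ultimately show ?case
      by (meson rtranclp.rtrancl_into_rtrancl rtranclp_trans)
  qed
  have "odd_model (verts G) (sadj (G, S)) n (cl \<circ> f) (\<sigma> \<circ> f)"
    unfolding odd_model_def
  proof (intro conjI allI impI ballI)
    fix i assume "i < n"
    then show "\<exists>v\<in>verts G. (cl \<circ> f) v = i"
      using odd_modelD(1)[OF m] G'f by auto
  next
    fix x y assume "x \<in> verts G" "y \<in> verts G" "(cl \<circ> f) x = (cl \<circ> f) y" "(cl \<circ> f) x < n"
    then have "(pos (sadj (G', S)) cl \<sigma>)\<^sup>*\<^sup>* (f x) (f y)"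
      using G'f by (intro odd_modelD(2)[OF m]) auto
    then show "?R\<^sup>*\<^sup>* x y"
      using path by blast
  next
    fix i j assume "i < n" "j < n" "i \<noteq> j"
    then obtain a b where "cl a = i" "cl b = j" "sadj (G', S) a b (\<sigma> a = \<sigma> b)"
      using odd_modelD(3)[OF m] by blast
    then show "\<exists>u\<in>verts G. \<exists>v\<in>verts G. (cl \<circ> f) u = i \<and> (cl \<circ> f) v = j
        \<and> sadj (G, S) u v ((\<sigma> \<circ> f) u = (\<sigma> \<circ> f) v)"
      using lift by fastforce
  qed
  then show ?thesis by blast
qed

text \<open>An invariant of minor sequences. Ends within the vertex set are what lifting through a
  contraction requires; that negative edges are edges serves to recognise an odd complete
  graph.\<close>

definition wf_sgraph :: "('v, 'e) sgraph \<Rightarrow> bool" where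
  "wf_sgraph M \<longleftrightarrow> fin_mgraph (fst M) \<and> snd M \<subseteq> edges (fst M)"

lemma wf_sgraph_minor_step:
  assumes "minor_step M N" "wf_sgraph M"
  shows "wf_sgraph N"
  using assms
proof cases
  case (contract e G S u v)
  let ?f = "\<lambda>x. if x = v then u else x"
  have "\<exists>a\<in>?f ` verts G. \<exists>b\<in>?f ` verts G. ?f ` ends G e' = {a, b}" if e': "e' \<in> edges G" for e'
  proof -
    obtain p q where "p \<in> verts G" "q \<in> verts G" "ends G e' = {p, q}"
      using e' assms(2) contract(1) unfolding wf_sgraph_def fin_mgraph_def by auto
    then show ?thesis
      by (intro bexI[of _ "?f p"] bexI[of _ "?f q"]) auto
  qed
  note ends = this
  have fin: "finite (verts G)" "finite (edges G)" "S \<subseteq> edges G"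
    using assms(2) contract(1) unfolding wf_sgraph_def fin_mgraph_def by auto
  have "fin_mgraph (contract_edge G e u v)"
    unfolding fin_mgraph_def contract_edge_def Let_def mgraph.select_convs
  proof (intro conjI ballI)
    fix e' assume "e' \<in> edges G - {e}"
    then show "\<exists>a\<in>?f ` verts G. \<exists>b\<in>?f ` verts G. ?f ` ends G e' = {a, b}"
      by (intro ends) simp
  qed (simp_all add: fin)
  moreover have "S \<subseteq> edges (contract_edge G e u v)"
    using fin(3) contract(4) by (auto simp: contract_edge_def)
  ultimately show ?thesis
    using contract(2) by (simp add: wf_sgraph_def)
next
  case (delete_vertex v G G' S)
  have fin: "fin_mgraph G" "S \<subseteq> edges G"
    using assms(2) delete_vertex(1) unfolding wf_sgraph_def by auto
  have "fin_mgraph G'"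
    unfolding fin_mgraph_def delete_vertex(4) delete_vertices_def mgraph.select_convs
  proof (intro conjI ballI)
    fix e assume e: "e \<in> {e \<in> edges G. ends G e \<inter> {v} = {}}"
    then obtain p q where "p \<in> verts G" "q \<in> verts G" "ends G e = {p, q}"
      using fin(1) unfolding fin_mgraph_def by blast
    then show "\<exists>p\<in>verts G - {v}. \<exists>q\<in>verts G - {v}. ends G e = {p, q}"
      using e by auto
  qed (use fin in \<open>simp_all add: fin_mgraph_def\<close>)
  then show ?thesis
    using delete_vertex(2) by (simp add: wf_sgraph_def)
qed (auto simp: wf_sgraph_def fin_mgraph_def delete_edge_def)

lemma odd_model_minor_step:
  assumes "minor_step M N" "wf_sgraph M" "odd_model (verts (fst N)) (sadj N) n cl \<sigma>"
  shows "\<exists>cl \<sigma>. odd_model (verts (fst M)) (sadj M) n cl \<sigma>"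
  using assms(1)
proof cases
  case (resign X G S' S)
  then show ?thesis
    using assms(3) odd_model_resign[of G S' n cl \<sigma> S X] by auto
next
  case (delete_edge e G S)
  then have A: "sadj M u v b" if "sadj N u v b" for u v b
    using that unfolding sadj_def Defs.delete_edge_def by auto
  have "odd_model (verts (fst N)) (sadj M) n cl \<sigma>"
    using assms(3) by (rule odd_model_mono) (erule A)+
  moreover have "verts (fst N) = verts (fst M)"
    using delete_edge by (simp add: Defs.delete_edge_def)
  ultimately have "odd_model (verts (fst M)) (sadj M) n cl \<sigma>"
    by simp
  then show ?thesis by blast
next
  case (delete_vertex v G G' S)
  then show ?thesis
    using assms(3) odd_model_delete_vertex[of G' S n cl \<sigma> G v] by auto
next
  case (contract e G S u v)
  then show ?thesis
    using assms(2,3) odd_model_contract[of _ S n cl \<sigma> G e u v] unfolding wf_sgraph_def by simp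
qed

text \<open>The vertices, numbered by the isomorphism, are singleton branch sets, and no switching
  is required.\<close>

lemma odd_model_iso:
  assumes iso: "sgraph_iso N (odd_sgraph (complete_graph n))" and wf: "wf_sgraph N"
  shows "\<exists>cl \<sigma>. odd_model (verts (fst N)) (sadj N) n cl \<sigma>"
proof -
  let ?E = "{e. e \<subseteq> {..<n} \<and> card e = 2}"
  obtain f g where f: "bij_betw f (verts (fst N)) {..<n}"
    and g: "bij_betw g (edges (fst N)) ?E"
    and fg: "\<forall>e\<in>edges (fst N). g e = f ` ends (fst N) e"
    and S: "g ` snd N = ?E"
    using iso unfolding sgraph_iso_def odd_sgraph_def complete_graph_def
      fst_conv snd_conv mgraph.select_convs id_apply by (elim exE conjE)
  \<comment> \<open>The injective map \<open>g\<close> sends the negative edges and all edges onto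
    the same set.\<close>
  have neg: "snd N = edges (fst N)"
  proof -
    have "inj_on g (edges (fst N))" "g ` snd N = g ` edges (fst N)"
      using g S unfolding bij_betw_def by simp_all
    then show ?thesis
      using wf inj_on_image_eq_iff[of g "edges (fst N)" "snd N" "edges (fst N)"]
      unfolding wf_sgraph_def by simp
  qed
  have inj: "u = v" if "u \<in> verts (fst N)" "v \<in> verts (fst N)" "f u = f v" for u v
    using f that unfolding bij_betw_def inj_on_def by blast
  have "odd_model (verts (fst N)) (sadj N) n f (\<lambda>_. False)"
    unfolding odd_model_def
  proof (intro conjI allI impI ballI)
    fix i assume "i < n"
    then show "\<exists>v\<in>verts (fst N). f v = i"
      using bij_betw_imp_surj_on[OF f] by (metis imageE lessThan_iff)
  next
    fix u v assume "u \<in> verts (fst N)" "v \<in> verts (fst N)" "f u = f v"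
    then show "(pos (sadj N) f (\<lambda>_. False))\<^sup>*\<^sup>* u v"
      using inj by auto
  next
    fix i j assume "i < n" "j < n" "i \<noteq> j"
    then have "{i, j} \<in> ?E" by auto
    then obtain e where e: "e \<in> edges (fst N)" "g e = {i, j}"
      unfolding bij_betw_imp_surj_on[OF g, symmetric] by auto
    have "\<exists>p q. ends (fst N) e = {p, q}"
      using wf e(1) unfolding wf_sgraph_def fin_mgraph_def by blast
    have "f ` ends (fst N) e = {i, j}"
      using e fg by simp
    then obtain p q where pq: "ends (fst N) e = {p, q}" "f p = i" "f q = j"
      using \<open>\<exists>p q. ends (fst N) e = {p, q}\<close> by (rule image_doubletonE)
    moreover have "p \<in> verts (fst N)" "q \<in> verts (fst N)"
      using wf e(1) pq(1) unfolding wf_sgraph_def fin_mgraph_def by fastforce+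
    ultimately show "\<exists>u\<in>verts (fst N). \<exists>v\<in>verts (fst N). f u = i \<and> f v = j
        \<and> sadj N u v (False = False)"
      using e(1) neg unfolding sadj_def by auto
  qed
  then show ?thesis by blast
qed

lemma odd_minor_free_if_no_odd_model:
  assumes "fin_mgraph G" and no: "\<And>cl \<sigma>. \<not> odd_model (verts G) (sadj (G, edges G)) n cl \<sigma>"
  shows "odd_minor_free (complete_graph n) G"
  unfolding odd_minor_free_def sgraph_odd_minor_free_def
proof
  assume "\<exists>N. sgraph_minor (G, edges G) N \<and> sgraph_iso N (odd_sgraph (complete_graph n))"
  then obtain N where N: "minor_step\<^sup>*\<^sup>* (G, edges G) N"
      and iso: "sgraph_iso N (odd_sgraph (complete_graph n))"
    unfolding sgraph_minor_def by blast
  have wf: "wf_sgraph (G, edges G)"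
    using assms by (simp add: wf_sgraph_def)
  \<comment> \<open>Well-formedness is carried forward along the minor sequence; the model found at
    its end is then carried backward.\<close>
  have "wf_sgraph N"
    using N wf by induction (simp, blast dest: wf_sgraph_minor_step)
  then obtain cl \<sigma> where m: "odd_model (verts (fst N)) (sadj N) n cl \<sigma>"
    using odd_model_iso[OF iso] by blast
  from N wf have "\<exists>cl \<sigma>. odd_model (verts (fst (G, edges G))) (sadj (G, edges G)) n cl \<sigma>"
  proof (induction rule: converse_rtranclp_induct)
    case base
    then show ?case using m by blast
  next
    case (step M M')
    have "wf_sgraph M'"
      using step.hyps(1) step.prems by (rule wf_sgraph_minor_step)
    then obtain cl \<sigma> where "odd_model (verts (fst M')) (sadj M') n cl \<sigma>"
      using step.IH by blast
    then show ?case
      by (rule odd_model_minor_step[OF step.hyps(1) step.prems])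
  qed
  then show False using no by simp
qed

section \<open>Branch sets and vertices of small degree\<close>

lemma card_neighbours_singleton_class:
  assumes m: "odd_model V A n cl \<sigma>" and i: "i < n"
    and single: "\<And>u. u \<in> V \<Longrightarrow> cl u = i \<Longrightarrow> u = t"
    and N: "finite N" "\<And>v b. A t v b \<Longrightarrow> v \<in> N"
  shows "n \<le> card N + 1"
proof -
  \<comment> \<open>Each of the other \<open>n - 1\<close> classes is joined to class
    \<open>i\<close>, hence contains a neighbour of its only vertex \<open>t\<close>.\<close>
  have "{..<n} - {i} \<subseteq> cl ` N"
  proof
    fix j assume "j \<in> {..<n} - {i}"
    then obtain u v where "u \<in> V" "cl u = i" "cl v = j" "A u v (\<sigma> u = \<sigma> v)"
      using odd_modelD(3)[OF m i] by blast
    then show "j \<in> cl ` N"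
      using single N(2) by blast
  qed
  then have "card ({..<n} - {i}) \<le> card N"
    using surj_card_le[OF N(1)] by blast
  then show ?thesis
    using i by simp
qed

lemma odd_model_step:
  assumes "odd_model V A n cl \<sigma>" "u \<in> V" "v \<in> V" "u \<noteq> v" "cl u = cl v" "cl u < n"
  obtains w where "cl w = cl u" "A u w (\<sigma> u \<noteq> \<sigma> w)"
proof -
  have "(pos A cl \<sigma>)\<^sup>*\<^sup>* u v"
    using odd_modelD(2)[OF assms(1)] assms by blast
  then obtain w where "pos A cl \<sigma> u w"
    using \<open>u \<noteq> v\<close> by (cases rule: converse_rtranclpE) auto
  then show thesis
    using that unfolding pos_def by metis
qed

text \<open>Signs multiply along a path through \<open>t\<close>, so the new edge is negative iff
  exactly one of the two old edges is. The condition \<open>u \<noteq> v\<close> prevents loops from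
  walks that turn back at \<open>t\<close>.\<close>

definition suppress :: "'v set \<Rightarrow> ('v \<Rightarrow> 'v \<Rightarrow> bool \<Rightarrow> bool) \<Rightarrow> 'v \<Rightarrow> 'v \<Rightarrow> bool \<Rightarrow> bool" where
  "suppress T A u v b \<longleftrightarrow> u \<notin> T \<and> v \<notin> T \<and>
     (A u v b \<or> u \<noteq> v \<and> (\<exists>t\<in>T. \<exists>b1 b2. A u t b1 \<and> A t v b2 \<and> b = (b1 \<noteq> b2)))"

text \<open>A connected branch set inside the independent set \<open>T\<close> would be a single
  vertex, which has too few neighbours. So every branch set keeps a vertex outside \<open>T\<close>,
  and its edges through \<open>T\<close> can be rerouted.\<close>

lemma odd_model_suppress:
  assumes m: "odd_model V A n cl \<sigma>"
    and A_sym: "\<And>u v b. A u v b \<Longrightarrow> A v u b"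
    and A_V: "\<And>u v b. A u v b \<Longrightarrow> u \<in> V"
    and T_indep: "\<And>t v b. t \<in> T \<Longrightarrow> A t v b \<Longrightarrow> v \<notin> T"
    and T_deg: "\<And>t. t \<in> T \<Longrightarrow> \<exists>N. finite N \<and> card N + 1 < n \<and> (\<forall>v b. A t v b \<longrightarrow> v \<in> N)"
  shows "odd_model (V - T) (suppress T A) n cl \<sigma>"
proof -
  let ?R = "pos A cl \<sigma>" and ?R' = "pos (suppress T A) cl \<sigma>"
  \<comment> \<open>When the path stands at a vertex of \<open>T\<close>, the invariant remembers
    the vertex \<open>w\<close> outside \<open>T\<close> from which it came.\<close>
  have path: "(v \<notin> T \<longrightarrow> ?R'\<^sup>*\<^sup>* u v) \<and> (v \<in> T \<longrightarrow> (\<exists>w. w \<notin> T \<and> ?R'\<^sup>*\<^sup>* u w \<and> ?R w v))"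
    if "?R\<^sup>*\<^sup>* u v" "u \<notin> T" for u v
    using that
  proof (induction rule: rtranclp_induct)
    case base
    then show ?case by simp
  next
    case (step v z)
    show ?case
    proof (cases "v \<in> T")
      case True
      then obtain w where w: "w \<notin> T" "?R'\<^sup>*\<^sup>* u w" "?R w v"
        using step by blast
      have z: "z \<notin> T"
        using T_indep[OF True] step(2) unfolding pos_def by blast
      have "?R'\<^sup>*\<^sup>* u z"
      proof (cases "w = z")
        case False
        have "A w v (\<sigma> w \<noteq> \<sigma> v)" "A v z (\<sigma> v \<noteq> \<sigma> z)" "cl w = cl z"
          using w(3) step(2) unfolding pos_def by auto
        moreover have "(\<sigma> w \<noteq> \<sigma> z) = ((\<sigma> w \<noteq> \<sigma> v) \<noteq> (\<sigma> v \<noteq> \<sigma> z))" by blast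
        ultimately have "?R' w z"
          using w(1) z True False unfolding pos_def suppress_def by blast
        then show ?thesis using w(2) by simp
      qed (use w in simp)
      then show ?thesis using z by blast
    next
      case False
      then have "?R'\<^sup>*\<^sup>* u v" using step by blast
      moreover have "?R' v z" if "z \<notin> T"
        using that False step(2) unfolding pos_def suppress_def by blast
      ultimately show ?thesis
        using False step(2) by (cases "z \<in> T") auto
    qed
  qed
  have proper: "\<exists>v\<in>V - T. cl v = i" if i: "i < n" for i
  proof (rule ccontr)
    assume "\<not> ?thesis"
    then have T: "v \<in> T" if "v \<in> V" "cl v = i" for v
      using that by blast
    obtain t where t: "t \<in> V" "cl t = i"
      using odd_modelD(1)[OF m i] by blast
    have "u = t" if u: "u \<in> V" "cl u = i" for u
    proof (rule ccontr)
      assume "u \<noteq> t"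
      then obtain w where "cl w = i" "A t w (\<sigma> t \<noteq> \<sigma> w)"
        using odd_model_step[OF m t(1) u(1)] t u i by metis
      then show False
        using T T_indep t A_V A_sym by blast
    qed
    moreover obtain N where N: "finite N" "card N + 1 < n" "\<forall>v b. A t v b \<longrightarrow> v \<in> N"
      using T_deg T t by blast
    ultimately have "n \<le> card N + 1"
      using card_neighbours_singleton_class[OF m i, of t N] by blast
    then show False
      using N(2) by simp
  qed
  \<comment> \<open>The branch set of \<open>t\<close> has further vertices, so a positive edge
    leads from \<open>t\<close> to some \<open>z\<close> in it. Followed by the negative edge
    \<open>tv\<close> it gives a negative edge \<open>zv\<close>; all signs are meant after
    switching.\<close>
  have half: "\<exists>z\<in>V - T. cl z = cl t \<and> suppress T A z v (\<sigma> z = \<sigma> v)"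
    if t: "t \<in> T" "t \<in> V" "cl t < n" and v: "cl v \<noteq> cl t" "A t v (\<sigma> t = \<sigma> v)" for t v
  proof -
    obtain w where "w \<in> V - T" "cl w = cl t"
      using proper t by blast
    then obtain z where z: "cl z = cl t" "A t z (\<sigma> t \<noteq> \<sigma> z)"
      using odd_model_step[OF m t(2)] t by (metis DiffD1 DiffD2)
    have "z \<in> V - T" "v \<notin> T" "A z t (\<sigma> t \<noteq> \<sigma> z)"
      using T_indep[OF t(1)] z(2) v(2) A_sym A_V by blast+
    moreover have "(\<sigma> z = \<sigma> v) = ((\<sigma> t \<noteq> \<sigma> z) \<noteq> (\<sigma> t = \<sigma> v))" by blast
    moreover have "z \<noteq> v" using z v by metis
    ultimately have "suppress T A z v (\<sigma> z = \<sigma> v)"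
      using t(1) v(2) unfolding suppress_def by blast
    then show ?thesis
      using z(1) \<open>z \<in> V - T\<close> by blast
  qed
  have suppress_sym: "suppress T A u v b" if "suppress T A v u b" for u v b
    using that A_sym unfolding suppress_def by metis
  show ?thesis
    unfolding odd_model_def
  proof (intro conjI allI impI ballI)
    fix i assume "i < n"
    then show "\<exists>v\<in>V - T. cl v = i" by (rule proper)
  next
    fix u v assume "u \<in> V - T" "v \<in> V - T" "cl u = cl v" "cl u < n"
    then show "?R'\<^sup>*\<^sup>* u v"
      using odd_modelD(2)[OF m] path by blast
  next
    fix i j assume ij: "i < n" "j < n" "i \<noteq> j"
    then obtain u v where uv: "u \<in> V" "v \<in> V" "cl u = i" "cl v = j" "A u v (\<sigma> u = \<sigma> v)"
      using odd_modelD(3)[OF m] by blast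
    consider "u \<in> T" | "v \<in> T" | "u \<notin> T" "v \<notin> T" by blast
    then show "\<exists>u\<in>V - T. \<exists>v\<in>V - T. cl u = i \<and> cl v = j \<and> suppress T A u v (\<sigma> u = \<sigma> v)"
    proof cases
      case 1
      moreover have "v \<in> V - T" using 1 uv T_indep by blast
      ultimately show ?thesis
        using half[of u v] uv ij by metis
    next
      case 2
      have "A v u (\<sigma> v = \<sigma> u)" using A_sym[OF uv(5)] by (simp add: eq_commute)
      moreover from this have "u \<in> V - T" using 2 uv T_indep by blast
      ultimately obtain z where "z \<in> V - T" "cl z = j" "suppress T A z u (\<sigma> z = \<sigma> u)"
        using half[of v u] 2 uv ij by metis
      moreover from this have "suppress T A u z (\<sigma> u = \<sigma> z)"
        using suppress_sym by (simp add: eq_commute)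
      ultimately show ?thesis
        using uv \<open>u \<in> V - T\<close> by blast
    next
      case 3
      then show ?thesis
        using uv unfolding suppress_def by blast
    qed
  qed
qed

text \<open>
  A vertex with fewer than \<open>n - 1\<close> neighbours cannot be a branch set of its own, so
  all \<open>n\<close> branch sets have at least, hence exactly, two of the \<open>2 * n\<close> vertices.
\<close>

lemma odd_model_perfect_matching:
  assumes m: "odd_model V A n cl \<sigma>" and V: "finite V" "card V = 2 * n"
    and A_V: "\<And>u v b. A u v b \<Longrightarrow> v \<in> V"
    and deg: "\<And>v. v \<in> V \<Longrightarrow> \<exists>N. finite N \<and> card N + 1 < n \<and> (\<forall>w b. A v w b \<longrightarrow> w \<in> N)"
    and irr: "\<And>v b. \<not> A v v b"
    and v: "v \<in> V"
  shows "cl v < n \<and> (\<exists>w. A v w (\<sigma> v \<noteq> \<sigma> w) \<and> {u \<in> V. cl u = cl v} = {v, w})"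
proof -
  let ?c = "\<lambda>i. {u \<in> V. cl u = i}"
  have ge2: "card (?c i) \<ge> 2" if i: "i < n" for i
  proof -
    obtain t where t: "t \<in> V" "cl t = i"
      using odd_modelD(1)[OF m i] by blast
    have "\<exists>u\<in>V. cl u = i \<and> u \<noteq> t"
    proof (rule ccontr)
      assume "\<not> ?thesis"
      moreover obtain N where "finite N" "card N + 1 < n" "\<forall>w b. A t w b \<longrightarrow> w \<in> N"
        using deg t by blast
      ultimately show False
        using card_neighbours_singleton_class[OF m i, of t N] by fastforce
    qed
    then obtain u where "u \<in> V" "cl u = i" "u \<noteq> t" by blast
    then have "card {u, t} \<le> card (?c i)"
      using t V by (intro card_mono) auto
    then show ?thesis
      using \<open>u \<noteq> t\<close> by simp
  qed
  have disj: "card (\<Union>i<n. ?c i) = (\<Sum>i<n. card (?c i))"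
    using V by (intro card_UN_disjoint) auto
  have tot: "(\<Sum>i<n. card (?c i)) \<le> (\<Sum>i<n. 2)"
    unfolding disj[symmetric] using V card_mono[OF V(1), of "\<Union>i<n. ?c i"] by fastforce
  have eq2: "card (?c i) = 2" if "i < n" for i
  proof (rule ccontr)
    assume "card (?c i) \<noteq> 2"
    then have "(\<Sum>i<n. 2) < (\<Sum>i<n. card (?c i))"
      using that ge2 by (intro sum_strict_mono_ex1) (auto intro!: bexI[of _ i] simp: le_neq_implies_less)
    then show False using tot by simp
  qed
  then have "card (\<Union>i<n. ?c i) = card V"
    unfolding disj using V by simp
  then have "(\<Union>i<n. ?c i) = V"
    using V by (intro card_subset_eq) auto
  then have cl: "cl v < n" using v by blast
  have "card (?c (cl v)) = 2" by (rule eq2[OF cl])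
  then obtain x y where xy: "?c (cl v) = {x, y}" "x \<noteq> y"
    unfolding card_2_iff by (elim exE conjE)
  have "v \<in> ?c (cl v)" using v by simp
  then have "v = x \<or> v = y" unfolding xy by blast
  then have "?c (cl v) = {v, y} \<and> y \<noteq> v \<or> ?c (cl v) = {v, x} \<and> x \<noteq> v"
    using xy by (elim disjE) (simp_all add: insert_commute)
  then obtain w where w: "?c (cl v) = {v, w}" "w \<noteq> v"
    by blast
  then have "w \<in> V" "cl w = cl v" by blast+
  \<comment> \<open>The only other vertex of the class is \<open>w\<close>, so a positive edge from
    \<open>v\<close> within the class must end there.\<close>
  then obtain z where z: "cl z = cl v" "A v z (\<sigma> v \<noteq> \<sigma> z)"
    using odd_model_step[OF m v] w cl by metis
  then have "z \<in> ?c (cl v)" "z \<noteq> v"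
    using A_V irr by blast+
  then have "z = w" using w by blast
  then show ?thesis using z w cl by blast
qed

text \<open>The branch sets are \<open>{u, w}\<close> and \<open>{v, z}\<close>. If they coincide,
  \<open>uv\<close> is the positive edge inside. If not, some negative edge joins them, and the
  \<open>girth\<close> assumptions exclude \<open>wv\<close>, \<open>uz\<close> and
  \<open>wz\<close>, leaving only \<open>uv\<close>.\<close>

lemma odd_model_edge_sign:
  assumes m: "odd_model V A n cl \<sigma>"
    and u: "cl u < n" "{x \<in> V. cl x = cl u} = {u, w}" "A u w (\<sigma> u \<noteq> \<sigma> w)"
    and v: "cl v < n" "{x \<in> V. cl x = cl v} = {v, z}" "A v z (\<sigma> v \<noteq> \<sigma> z)"
    and girth: "\<And>w b b'. A u w b \<Longrightarrow> w \<noteq> v \<Longrightarrow> \<not> A w v b'"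
      "\<And>z b b'. A v z b \<Longrightarrow> z \<noteq> u \<Longrightarrow> \<not> A u z b'"
      "\<And>w z b b' b''. A u w b \<Longrightarrow> A v z b' \<Longrightarrow> w \<noteq> v \<Longrightarrow> z \<noteq> u \<Longrightarrow> \<not> A w z b''"
    and neq: "u \<noteq> v"
  shows "A u v ((cl u = cl v) = (\<sigma> u \<noteq> \<sigma> v))"
proof (cases "cl u = cl v")
  case True
  have "v \<in> {x \<in> V. cl x = cl v}" using v(2) by blast
  then have "w = v" using True u(2) neq by auto
  then show ?thesis using True u(3) by simp
next
  case False
  obtain x y where xy: "x \<in> V" "y \<in> V" "cl x = cl u" "cl y = cl v" "A x y (\<sigma> x = \<sigma> y)"
    using odd_modelD(3)[OF m u(1) v(1) False] by blast
  have "x \<in> {x \<in> V. cl x = cl u}" "y \<in> {x \<in> V. cl x = cl v}"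
    using xy by simp_all
  then have x: "x = u \<or> x = w" and y: "y = v \<or> y = z"
    using u(2) v(2) by simp_all
  have "w \<in> {x \<in> V. cl x = cl u}" "z \<in> {x \<in> V. cl x = cl v}"
    using u(2) v(2) by simp_all
  then have "w \<noteq> v" "z \<noteq> u" using False by auto
  then have "x = u" "y = v"
    using x y xy(5) girth u(3) v(3) by metis+
  then show ?thesis using xy(5) False by simp
qed

section \<open>Cycles in even cycle decompositions\<close>

text \<open>A vertex occurs once in the cyclic vertex list, so it meets only the edge at its own
  position and the one before. These differ, as a cycle of length 1 would be a loop.\<close>

lemma cycle_edges_at_vertex:
  assumes C: "cycle_edges G C" and G: "loopless G" and e: "e \<in> C" "v \<in> ends G e"
  shows "\<exists>e'. e' \<noteq> e \<and> {f \<in> C. v \<in> ends G f} = {e, e'}"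
proof -
  obtain vs es where C: "C \<subseteq> edges G" "es \<noteq> []" "length vs = length es" "distinct vs"
      "distinct es" "set es = C"
      "\<forall>i<length es. ends G (es ! i) = {vs ! i, vs ! (Suc i mod length vs)}"
    using C unfolding cycle_edges_def by (elim exE conjE)
  define n where "n = length es"
  have n: "n > 1"
  proof (rule ccontr)
    assume "\<not> n > 1"
    then have "n = 1" using C(2) n_def by (cases es) auto
    then have "ends G (es ! 0) = {vs ! 0}" "es ! 0 \<in> edges G"
      using C n_def by auto
    then show False using G unfolding loopless_def by blast
  qed
  have ends: "ends G (es ! i) = {vs ! i, vs ! (Suc i mod n)}" if "i < n" for i
    using C(3,7) that n_def by simp
  obtain i where i: "i < n" "e = es ! i"
    using e(1) C(6) n_def by (auto simp: in_set_conv_nth)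
  then have "v = vs ! i \<or> v = vs ! (Suc i mod n)"
    using e(2) ends by blast
  moreover have "Suc i mod n < n" using n by simp
  ultimately obtain k where k: "k < n" "v = vs ! k"
    using i(1) by blast
  \<comment> \<open>The cyclic predecessor of \<open>k\<close>.\<close>
  define p where "p = (if k = 0 then n - 1 else k - 1)"
  have p: "p < n" "p \<noteq> k"
    using k n by (auto simp: p_def)
  have succ: "Suc i mod n = k \<longleftrightarrow> i = p" if "i < n" for i
    using that k n by (cases "Suc i = n") (auto simp: p_def)
  have at_v: "v \<in> ends G (es ! i) \<longleftrightarrow> i = k \<or> i = p" if "i < n" for i
  proof -
    have "Suc i mod n < n" using n by simp
    then have "v \<in> ends G (es ! i) \<longleftrightarrow> i = k \<or> Suc i mod n = k"
      using that k C(3,4) n_def ends nth_eq_iff_index_eq[of vs] by auto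
    then show ?thesis using succ that by simp
  qed
  have "{f \<in> C. v \<in> ends G f} = {es ! k, es ! p}"
  proof (intro equalityI subsetI)
    fix f assume "f \<in> {f \<in> C. v \<in> ends G f}"
    then obtain i where "i < n" "f = es ! i" "v \<in> ends G (es ! i)"
      using C(6) n_def by (auto simp: in_set_conv_nth)
    then show "f \<in> {es ! k, es ! p}"
      using at_v by blast
  next
    fix f assume "f \<in> {es ! k, es ! p}"
    then show "f \<in> {f \<in> C. v \<in> ends G f}"
      using at_v k(1) p(1) C(6) n_def by auto
  qed
  moreover have "es ! k \<noteq> es ! p"
    using C(5) k p n_def by (simp add: nth_eq_iff_index_eq)
  moreover have "e \<in> {f \<in> C. v \<in> ends G f}"
    using e by simp
  ultimately show ?thesis
    by (metis insertE insert_commute singletonD)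
qed

text \<open>Consecutive edges of the cycle share a vertex, so going once around the cycle from an
  edge of \<open>D\<close> never leaves \<open>D\<close>.\<close>

lemma cycle_edges_minimal:
  assumes C: "cycle_edges G C" and D: "D \<subseteq> C" "D \<noteq> {}"
    and closed: "\<And>d e v. d \<in> D \<Longrightarrow> e \<in> C \<Longrightarrow> v \<in> ends G d \<Longrightarrow> v \<in> ends G e \<Longrightarrow> e \<in> D"
  shows "D = C"
proof -
  obtain vs es where C: "es \<noteq> []" "length vs = length es" "set es = C"
      "\<forall>i<length es. ends G (es ! i) = {vs ! i, vs ! (Suc i mod length vs)}"
    using C unfolding cycle_edges_def by (elim exE conjE)
  define n where "n = length es"
  have n: "n > 0" using C(1) n_def by simp
  obtain k where k: "k < n" "es ! k \<in> D"
    using D C(3) n_def by (metis all_not_in_conv in_set_conv_nth subsetD)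
  have step: "es ! (Suc i mod n) \<in> D" if "i < n" "es ! i \<in> D" for i
  proof (rule closed)
    show "es ! i \<in> D" by fact
    have "Suc i mod n < n" using n by simp
    then show "es ! (Suc i mod n) \<in> C" "vs ! (Suc i mod n) \<in> ends G (es ! (Suc i mod n))"
      using C(2,3,4) n_def by auto
    show "vs ! (Suc i mod n) \<in> ends G (es ! i)"
      using C(2,4) that(1) n_def by simp
  qed
  have reach: "es ! ((k + j) mod n) \<in> D" for j
  proof (induction j)
    case (Suc j)
    have "Suc ((k + j) mod n) mod n = (k + Suc j) mod n"
      by (simp add: mod_Suc_eq)
    then show ?case
      using step[of "(k + j) mod n"] Suc n by simp
  qed (use k in simp)
  have "es ! i \<in> D" if "i < n" for i
  proof -
    \<comment> \<open>\<open>n - k + i\<close> steps from position \<open>k\<close> lead past the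
      end of the list to position \<open>i\<close>.\<close>
    have "(k + (n - k + i)) mod n = i"
      using that k(1) by simp
    then show ?thesis using reach[of "n - k + i"] by simp
  qed
  then show ?thesis
    using D(1) C(3) n_def by (metis in_set_conv_nth subsetI subset_antisym)
qed

text \<open>The partition becomes a colouring of the edges by their cycles, so that membership turns
  into equations \<open>c e = c e'\<close>.\<close>

lemma even_cycle_decomposableD:
  assumes "even_cycle_decomposable G"
  shows "\<exists>c. \<forall>e\<in>edges G. (\<forall>e'. e' \<in> c e \<longleftrightarrow> e' \<in> edges G \<and> c e' = c e) \<and>
           cycle_edges G (c e) \<and> even (card (c e))"
proof -
  obtain P where P: "partition_on (edges G) P" "\<forall>C\<in>P. cycle_edges G C \<and> even (card C)"
    using assms unfolding even_cycle_decomposable_def by blast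
  define c where "c e = (THE C. C \<in> P \<and> e \<in> C)" for e
  have un: "C = D" if "C \<in> P" "D \<in> P" "e \<in> C" "e \<in> D" for C D e
    using partition_onD2[OF P(1)] that unfolding disjoint_def by blast
  have c: "c e = C" if "C \<in> P" "e \<in> C" for C e
    unfolding c_def using that un by (intro the_equality) blast+
  have P_Union: "\<Union>P = edges G"
    using partition_onD1[OF P(1)] by simp
  show ?thesis
  proof (intro exI[of _ c] ballI conjI allI iffI)
    fix e assume e: "e \<in> edges G"
    then obtain C where C: "C \<in> P" "e \<in> C" "c e = C"
      using P_Union c by blast
    show "cycle_edges G (c e)" "even (card (c e))" using P(2) C by simp_all
    fix e'
    show "e' \<in> edges G" "c e' = c e" if "e' \<in> c e"
      using that C P_Union c by blast+
    show "e' \<in> c e" if "e' \<in> edges G \<and> c e' = c e"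
      using that P_Union c by blast
  qed
qed

lemma cycle_edges_at_vertex_unique:
  assumes C: "cycle_edges G C" "loopless G"
    and d: "d \<in> C" "d' \<in> C" "d \<noteq> d'" "v \<in> ends G d" "v \<in> ends G d'"
    and e: "e \<in> C" "v \<in> ends G e"
  shows "e = d \<or> e = d'"
proof -
  obtain d'' where "{f \<in> C. v \<in> ends G f} = {d, d''}"
    using cycle_edges_at_vertex[OF C d(1,4)] by blast
  then have "d' \<in> {d, d''}" "e \<in> {d, d''}"
    using d e by blast+
  then show ?thesis using d(3) by blast
qed

text \<open>At each corner the two triangle edges are already all edges of the cycle there, so the
  triangle is closed under sharing vertices and minimality applies.\<close>

lemma cycle_edges_triangle:
  assumes C: "cycle_edges G C" "loopless G"
    and xyz: "x \<in> C" "y \<in> C" "z \<in> C" "x \<noteq> y" "y \<noteq> z" "x \<noteq> z"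
    and ends: "ends G x = {u, v}" "ends G y = {v, w}" "ends G z = {w, u}"
  shows "card C = 3"
proof -
  have "{x, y, z} = C"
  proof (rule cycle_edges_minimal[OF C(1)])
    fix d e p assume d: "d \<in> {x, y, z}" and e: "e \<in> C" "p \<in> ends G d" "p \<in> ends G e"
    then have "p = u \<or> p = v \<or> p = w" using ends by auto
    then show "e \<in> {x, y, z}"
      using cycle_edges_at_vertex_unique[OF C xyz(1,2,4) _ _ e(1,3)]
        cycle_edges_at_vertex_unique[OF C xyz(2,3,5) _ _ e(1,3)]
        cycle_edges_at_vertex_unique[OF C xyz(1,3,6) _ _ e(1,3)] ends by blast
  qed (use xyz in auto)
  then show ?thesis using xyz by auto
qed

section \<open>An st-numbering criterion for 2-connectedness\<close>

text \<open>
  The vertex order is an st-numbering: after deleting a vertex \<open>x\<close>, the vertices below \<open>x\<close> descend to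
  \<open>s\<close>, those above \<open>x\<close> ascend to \<open>t\<close>.
\<close>

lemma k_connected_2_st_order:
  fixes G :: "('v :: linorder, 'e) mgraph"
  assumes fin: "finite (verts G)" and card: "2 < card (verts G)"
    and s: "s \<in> verts G" "t \<in> verts G" and st: "adjacent G s t"
    and down: "\<And>v. v \<in> verts G \<Longrightarrow> v \<noteq> s \<Longrightarrow> \<exists>u\<in>verts G. u < v \<and> adjacent G u v"
    and up: "\<And>v. v \<in> verts G \<Longrightarrow> v \<noteq> t \<Longrightarrow> \<exists>w\<in>verts G. v < w \<and> adjacent G v w"
  shows "k_connected 2 G"
  unfolding k_connected_def
proof (intro conjI allI impI card)
  fix X assume X: "X \<subseteq> verts G" "card X < 2"
  let ?V = "verts G - X" and ?R = "adjacent (delete_vertices G X)"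
  have adj: "?R u v" if "adjacent G u v" "u \<notin> X" "v \<notin> X" for u v
    using that unfolding adjacent_def delete_vertices_def by auto
  have sym: "?R\<^sup>*\<^sup>* u v \<Longrightarrow> ?R\<^sup>*\<^sup>* v u" for u v
  proof -
    have "symp ?R"
      by (auto simp: symp_def adjacent_def insert_commute)
    then show "?R\<^sup>*\<^sup>* u v \<Longrightarrow> ?R\<^sup>*\<^sup>* v u"
      by (metis symp_rtranclp sympD)
  qed
  \<comment> \<open>At most one vertex is deleted, so every remaining vertex lies below or above all
    of \<open>X\<close>.\<close>
  obtain x where x: "X \<subseteq> {x}"
    using X fin by (metis card_1_singleton_iff card_eq_0_iff empty_subsetI finite_subset
        less_2_cases_iff order_refl One_nat_def)
  have min: "s \<le> v" if "v \<in> verts G" for v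
  proof -
    have "Min (verts G) \<in> verts G" using fin s by (intro Min_in) auto
    then have "Min (verts G) = s"
      using down[of "Min (verts G)"] Min_le[OF fin] by (meson leD)
    then show ?thesis using Min_le[OF fin that] by simp
  qed
  have max: "v \<le> t" if "v \<in> verts G" for v
  proof -
    have "Max (verts G) \<in> verts G" using fin s by (intro Max_in) auto
    then have "Max (verts G) = t"
      using up[of "Max (verts G)"] Max_ge[OF fin] by (meson leD)
    then show ?thesis using Max_ge[OF fin that] by simp
  qed
  have to_s: "?R\<^sup>*\<^sup>* s v" if "v \<in> ?V" "\<forall>y\<in>X. v < y" for v
  proof -
    have "finite {u \<in> verts G. u < w}" for w using fin by simp
    then show ?thesis using that
    proof (induction "card {u \<in> verts G. u < v}" arbitrary: v rule: less_induct)
      case less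
      show ?case
      proof (cases "v = s")
        case False
        then obtain u where u: "u \<in> verts G" "u < v" "adjacent G u v"
          using down less.prems by blast
        have "u \<notin> X" "\<forall>y\<in>X. u < y"
          using u less.prems by force+
        moreover have "card {w \<in> verts G. w < u} < card {w \<in> verts G. w < v}"
          using u fin by (intro psubset_card_mono) auto
        ultimately have "?R\<^sup>*\<^sup>* s u"
          using less.hyps[of u] u fin by simp
        then show ?thesis
          using adj[OF u(3)] \<open>u \<notin> X\<close> less.prems by (meson DiffD2 rtranclp.rtrancl_into_rtrancl)
      qed simp
    qed
  qed
  have to_t: "?R\<^sup>*\<^sup>* v t" if "v \<in> ?V" "\<forall>y\<in>X. y < v" for v
    using that
  proof (induction "card {u \<in> verts G. v < u}" arbitrary: v rule: less_induct)
    case less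
    show ?case
    proof (cases "v = t")
      case False
      then obtain w where w: "w \<in> verts G" "v < w" "adjacent G v w"
        using up less.prems by blast
      have "w \<notin> X" "\<forall>y\<in>X. y < w"
        using w less.prems by force+
      moreover have "card {u \<in> verts G. w < u} < card {u \<in> verts G. v < u}"
        using w fin by (intro psubset_card_mono) auto
      ultimately have "?R\<^sup>*\<^sup>* w t"
        using less.hyps[of w] w by simp
      then show ?thesis
        using adj[OF w(3)] \<open>w \<notin> X\<close> less.prems by (meson DiffD2 converse_rtranclp_into_rtranclp)
    qed simp
  qed
  \<comment> \<open>Every remaining vertex is reached from \<open>r\<close>. If neither
    \<open>s\<close> nor \<open>t\<close> is deleted, the edge \<open>st\<close> links the upper
    part to \<open>s\<close>.\<close>
  define r where "r = (if s \<in> X then t else s)"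
  have r: "?R\<^sup>*\<^sup>* r v" if v: "v \<in> ?V" for v
  proof -
    have xv: "v \<noteq> y" if "y \<in> X" for y using v that by blast
    consider "\<forall>y\<in>X. v < y" | "\<forall>y\<in>X. y < v"
      using x xv by (metis empty_iff insert_iff neqE subset_iff)
    then show ?thesis
    proof cases
      case 1
      then have "s \<notin> X" using min v by fastforce
      then show ?thesis using 1 to_s v r_def by simp
    next
      case 2
      then have "t \<notin> X" using max v by fastforce
      then have "?R s t" if "s \<notin> X" using adj[OF st that] by simp
      then show ?thesis
        using sym[OF to_t[OF v 2]] r_def by (metis converse_rtranclp_into_rtranclp)
    qed
  qed
  have "card X < card (verts G)" using card X by simp
  then have "?V \<noteq> {}" using X by auto
  moreover have "?R\<^sup>*\<^sup>* u v" if "u \<in> ?V" "v \<in> ?V" for u v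
    using sym[OF r[OF that(1)]] r[OF that(2)] by (rule rtranclp_trans)
  moreover have "verts (delete_vertices G X) = ?V"
    by (simp add: delete_vertices_def)
  ultimately show "connected (delete_vertices G X)"
    unfolding connected_def by simp
qed

section \<open>The Petersen graph with triangles on its spokes\<close>

text \<open>Edges are list positions and the orientation of the pairs is immaterial; incidences can
  thus be computed by evaluating lists.\<close>

definition list_graph :: "nat \<Rightarrow> (nat \<times> nat) list \<Rightarrow> (nat, nat) mgraph" where
  "list_graph n es =
     \<lparr>verts = {..<n}, edges = {..<length es}, ends = (\<lambda>e. {fst (es ! e), snd (es ! e)})\<rparr>"

lemma list_graph_simps [simp]:
  "verts (list_graph n es) = {..<n}"
  "edges (list_graph n es) = {..<length es}"
  "ends (list_graph n es) e = {fst (es ! e), snd (es ! e)}"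
  by (simp_all add: list_graph_def)

lemma ex_ends_list_graph:
  "(\<exists>e\<in>edges (list_graph n es). ends (list_graph n es) e = {u, v}) \<longleftrightarrow>
     (u, v) \<in> set es \<or> (v, u) \<in> set es"
  by (auto simp: doubleton_eq_iff in_set_conv_nth prod_eq_iff)

lemma fin_mgraph_list_graph:
  assumes "\<forall>(u, v)\<in>set es. u < n \<and> v < n"
  shows "fin_mgraph (list_graph n es)"
  using assms unfolding fin_mgraph_def by (fastforce dest: nth_mem)

lemma loopless_list_graph:
  assumes "\<forall>(u, v)\<in>set es. u \<noteq> v"
  shows "loopless (list_graph n es)"
  using assms unfolding loopless_def by (fastforce dest: nth_mem)

lemma eulerian_list_graph:
  assumes es: "\<forall>(u, v)\<in>set es. u \<noteq> v"
    and deg: "\<forall>v<n. even (length (filter (\<lambda>(a, b). v = a \<or> v = b) es))"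
  shows "eulerian (list_graph n es)"
proof -
  have "degree (list_graph n es) v = length (filter (\<lambda>(a, b). v = a \<or> v = b) es)" for v
  proof -
    have "{e. e < length es \<and> {fst (es ! e), snd (es ! e)} = {v}} = {}"
      using es nth_mem by fastforce
    then show ?thesis
      by (simp add: degree_def length_filter_conv_card case_prod_beta)
  qed
  then show ?thesis
    using deg by (simp add: eulerian_def)
qed

text \<open>
  The outer cycle is \<open>0, 2, 3, 4, 5\<close> with its edge \<open>02\<close> subdivided by \<open>1\<close>, the inner cycle is
  \<open>11, \<dots>, 15\<close>, and \<open>6, \<dots>, 10\<close> subdivide the second copies of the spokes. The labels
  are chosen such that their natural order is an st-numbering.
\<close>

definition petersen_edges :: "(nat \<times> nat) list" where
  "petersen_edges =
    [(0, 1), (1, 2), (2, 3), (3, 4), (4, 5), (5, 0),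
     (11, 12), (12, 13), (13, 14), (14, 15), (15, 11),
     (0, 15), (2, 13), (3, 11), (4, 14), (5, 12),
     (0, 6), (2, 7), (3, 8), (4, 9), (5, 10),
     (6, 15), (7, 13), (8, 11), (9, 14), (10, 12)]"

abbreviation petersen_triangles :: "(nat, nat) mgraph" where
  "petersen_triangles \<equiv> list_graph 16 petersen_edges"

section \<open>Degrees and 2-connectedness of the graph\<close>

lemma less_16_cases: "(\<forall>v<16. P v) \<longleftrightarrow> P 0 \<and> P 1 \<and> P 2 \<and> P 3 \<and> P 4 \<and> P 5 \<and> P 6 \<and> P 7 \<and>
    P 8 \<and> P 9 \<and> P 10 \<and> P 11 \<and> P 12 \<and> P 13 \<and> P 14 \<and> P (15::nat)"
  by (simp add: numeral_eq_Suc All_less_Suc conj_ac)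

lemma petersen_loopless: "\<forall>(u, v)\<in>set petersen_edges. u \<noteq> v"
  by (simp add: petersen_edges_def)

lemma petersen_eulerian: "eulerian petersen_triangles"
  by (rule eulerian_list_graph[OF petersen_loopless])
    (simp add: less_16_cases petersen_edges_def)

lemma petersen_k_connected: "k_connected 2 petersen_triangles"
proof (rule k_connected_2_st_order)
  have adj: "adjacent petersen_triangles u v \<longleftrightarrow>
      (u, v) \<in> set petersen_edges \<or> (v, u) \<in> set petersen_edges" for u v
    unfolding adjacent_def by (rule ex_ends_list_graph)
  show "adjacent petersen_triangles 0 15"
    unfolding adj by (simp add: petersen_edges_def)
  have "\<forall>v<16. v \<noteq> 0 \<longrightarrow>
      (\<exists>(a, b)\<in>set petersen_edges. a < v \<and> b = v \<or> b < v \<and> a = v)"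
    unfolding less_16_cases by (simp add: petersen_edges_def)
  then show "\<exists>u\<in>verts petersen_triangles. u < v \<and> adjacent petersen_triangles u v"
    if "v \<in> verts petersen_triangles" "v \<noteq> 0" for v
    using that unfolding adj by fastforce
  have "\<forall>v<16. v \<noteq> 15 \<longrightarrow>
      (\<exists>(a, b)\<in>set petersen_edges. a = v \<and> v < b \<and> b < 16 \<or> b = v \<and> v < a \<and> a < 16)"
    unfolding less_16_cases by (simp add: petersen_edges_def)
  then show "\<exists>w\<in>verts petersen_triangles. v < w \<and> adjacent petersen_triangles v w"
    if "v \<in> verts petersen_triangles" "v \<noteq> 15" for v
    using that unfolding adj by fastforce
qed simp_all

section \<open>Absence of an even cycle decomposition\<close>

lemma petersen_not_even_cycle_decomposable: "\<not> even_cycle_decomposable petersen_triangles"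
proof
  let ?G = petersen_triangles
  have ll: "loopless ?G"
    by (rule loopless_list_graph[OF petersen_loopless])
  have "length petersen_edges = 26"
    by (simp add: petersen_edges_def)
  then have edges: "e \<in> edges ?G \<longleftrightarrow> e < 26" for e
    by simp
  assume "even_cycle_decomposable ?G"
  from even_cycle_decomposableD[OF this]
  obtain c where "\<forall>e\<in>edges ?G. (\<forall>e'. e' \<in> c e \<longleftrightarrow> e' \<in> edges ?G \<and> c e' = c e) \<and>
      cycle_edges ?G (c e) \<and> even (card (c e))" ..
  note c = bspec[OF this, unfolded edges]
  have c: "e \<in> c e" "e' \<in> c e \<longleftrightarrow> e' < 26 \<and> c e' = c e" "cycle_edges ?G (c e)"
      "even (card (c e))" if "e < 26" for e e'
    using c[OF that] that by simp_all
  let ?I = "\<lambda>v. {e. e < 26 \<and> v \<in> ends ?G e}"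
  have partner: "\<exists>e'\<in>?I v. e' \<noteq> e \<and> c e' = c e" if "e \<in> ?I v" for e v
  proof -
    have e: "e < 26" "v \<in> ends ?G e" using that by simp_all
    obtain e' where e': "e' \<noteq> e" "{f \<in> c e. v \<in> ends ?G f} = {e, e'}"
      using cycle_edges_at_vertex[OF c(3)[OF e(1)] ll c(1)[OF e(1)] e(2)] by (elim exE conjE)
    then have "e' \<in> c e" "v \<in> ends ?G e'" by blast+
    then show ?thesis
      using e'(1) c(2)[OF e(1), of e'] by blast
  qed
  have pair: "c p = c q" if "?I v = {p, q}" for v p q
    using partner[of p v] unfolding that by auto
  \<comment> \<open>Here \<open>p\<close>, \<open>q\<close> are the two copies of a spoke and
    \<open>a\<close>, \<open>b\<close> the other two edges at one of its ends.\<close>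
  have quad: "c p = c a \<and> c q = c b \<or> c p = c b \<and> c q = c a"
    if I: "?I v = {a, b, p, q}" and neq: "c p \<noteq> c q" for v a b p q
  proof -
    have "c a = c p \<or> c b = c p" "c a = c q \<or> c b = c q"
      using partner[of p v] partner[of q v] neq unfolding I by auto
    then show ?thesis
      using neq by metis
  qed
  \<comment> \<open>\<open>x\<close> is the unsubdivided copy of a spoke, \<open>y\<close> and
    \<open>z\<close> are the halves of the other. A cycle with all three edges has odd length
    3.\<close>
  have triangle: "c x \<noteq> c y"
    if xyz: "x < 26" "y < 26" "z < 26" "distinct [x, y, z]" and "c y = c z"
      and ends: "ends ?G x = {u, v}" "ends ?G y = {u, w}" "ends ?G z = {w, v}" for x y z u v w
  proof
    assume "c x = c y"
    then have "x \<in> c x" "z \<in> c x" "y \<in> c x"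
      using c xyz \<open>c y = c z\<close> by metis+
    then have "card (c x) = 3"
      using cycle_edges_triangle[of ?G "c x" x z y u v w] c(3)[OF xyz(1)] ll xyz(4) ends
      by (auto simp: insert_commute)
    then show False
      using c(4)[OF xyz(1)] by simp
  qed
  have I: "?I v = set (filter (\<lambda>e. v \<in> ends ?G e) [0..<26])" for v
    by auto
  have upt: "[0..<26] = [0,1,2,3,4,5,6,7,8,9,10,11,12,13,14,15,16,17,18,19,20,21,22,23,24,25]"
    by (simp add: upt_conv_Cons)
  have I_deg2: "?I 1 = {0, 1}" "?I 6 = {16, 21}" "?I 7 = {17, 22}" "?I 8 = {18, 23}"
      "?I 9 = {19, 24}" "?I 10 = {20, 25}"
    unfolding I upt by (simp_all add: petersen_edges_def)
  have I_outer: "?I 0 = {0, 5, 11, 16}" "?I 2 = {1, 2, 12, 17}" "?I 3 = {2, 3, 13, 18}"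
      "?I 4 = {3, 4, 14, 19}" "?I 5 = {4, 5, 15, 20}"
    unfolding I upt by (simp_all add: petersen_edges_def)
  have I_inner: "?I 11 = {6, 10, 13, 23}" "?I 12 = {6, 7, 15, 25}" "?I 13 = {7, 8, 12, 22}"
      "?I 14 = {8, 9, 14, 24}" "?I 15 = {9, 10, 11, 21}"
    unfolding I upt by (simp_all add: petersen_edges_def insert_commute)
  note deg2 = I_deg2[THEN pair]
  have spokes: "c 11 \<noteq> c 16" "c 12 \<noteq> c 17" "c 13 \<noteq> c 18" "c 14 \<noteq> c 19" "c 15 \<noteq> c 20"
    using triangle[of 11 16 21 0 15 6] triangle[of 12 17 22 2 13 7] triangle[of 13 18 23 3 11 8]
      triangle[of 14 19 24 4 14 9] triangle[of 15 20 25 5 12 10] deg2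
    by (simp_all add: petersen_edges_def)
  have outer: "c 11 = c 0 \<and> c 16 = c 5 \<or> c 11 = c 5 \<and> c 16 = c 0"
      "c 12 = c 0 \<and> c 17 = c 2 \<or> c 12 = c 2 \<and> c 17 = c 0"
      "c 13 = c 2 \<and> c 18 = c 3 \<or> c 13 = c 3 \<and> c 18 = c 2"
      "c 14 = c 3 \<and> c 19 = c 4 \<or> c 14 = c 4 \<and> c 19 = c 3"
      "c 15 = c 4 \<and> c 20 = c 5 \<or> c 15 = c 5 \<and> c 20 = c 4"
    using I_outer[THEN quad] spokes deg2 by simp_all
  have inner: "c 13 = c 6 \<and> c 18 = c 10 \<or> c 13 = c 10 \<and> c 18 = c 6"
      "c 15 = c 6 \<and> c 20 = c 7 \<or> c 15 = c 7 \<and> c 20 = c 6"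
      "c 12 = c 7 \<and> c 17 = c 8 \<or> c 12 = c 8 \<and> c 17 = c 7"
      "c 14 = c 8 \<and> c 19 = c 9 \<or> c 14 = c 9 \<and> c 19 = c 8"
      "c 11 = c 9 \<and> c 16 = c 10 \<or> c 11 = c 10 \<and> c 16 = c 9"
    using I_inner[THEN quad] spokes deg2 by simp_all
  \<comment> \<open>Contracting the spokes yields \<open>K_5\<close>, where each colour present at a
    vertex lies on one outer and one inner edge. So each colour class is a cycle alternating between
    the two kinds, hence of length 4, but 4 does not divide 10.\<close>
  show False
    using spokes outer inner by metis
qed

section \<open>Absence of an odd-\<open>K_5\<close>-minor\<close>

text \<open>
  The signed Petersen graph that remains of \<open>petersen_triangles\<close>, with all edges negative, when
  the vertices of degree two are suppressed.
\<close>

definition petersen_adj :: "(nat \<times> nat \<times> bool) list" where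
  "petersen_adj =
    [(0, 2, False), (2, 3, True), (3, 4, True), (4, 5, True), (5, 0, True),
     (11, 12, True), (12, 13, True), (13, 14, True), (14, 15, True), (15, 11, True),
     (0, 15, True), (2, 13, True), (3, 11, True), (4, 14, True), (5, 12, True),
     (0, 15, False), (2, 13, False), (3, 11, False), (4, 14, False), (5, 12, False)]"

lemma petersen_odd_minor_free: "odd_minor_free (complete_graph 5) petersen_triangles"
proof (rule odd_minor_free_if_no_odd_model)
  show "fin_mgraph petersen_triangles"
    by (rule fin_mgraph_list_graph) (simp add: petersen_edges_def)
  fix cl :: "nat \<Rightarrow> nat" and \<sigma>
  let ?A = "sadj (petersen_triangles, edges petersen_triangles)"
  \<comment> \<open>The vertices of degree two.\<close>
  define T :: "nat set" where "T = {1, 6, 7, 8, 9, 10}"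
  let ?B = "suppress T ?A"
  have A: "?A u v b \<longleftrightarrow> b \<and> ((u, v) \<in> set petersen_edges \<or> (v, u) \<in> set petersen_edges)" for u v b
    using ex_ends_list_graph[of 16 petersen_edges u v] unfolding sadj_def by auto
  have A_less: "u < 16 \<and> v < 16" if "?A u v b" for u v b
    using that unfolding A unfolding petersen_edges_def by auto
  \<comment> \<open>Pairs of a vertex of \<open>T\<close> and one of its two neighbours.\<close>
  define sp :: "(nat \<times> nat) list" where "sp = [(1, 0), (1, 2), (6, 0), (6, 15), (7, 2), (7, 13), (8, 3), (8, 11), (9, 4), (9, 14),
      (10, 5), (10, 12)]"
  have "\<forall>(x, y)\<in>set petersen_edges. (x \<in> T \<longrightarrow> (x, y) \<in> set sp) \<and>
      (y \<in> T \<longrightarrow> (y, x) \<in> set sp)"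
    by (simp add: petersen_edges_def T_def sp_def)
  then have A_T: "b \<and> (t, v) \<in> set sp" if "?A t v b" "t \<in> T" for t v b
    using that unfolding A by blast
  have "\<forall>(x, y)\<in>set petersen_edges. x \<notin> T \<longrightarrow> y \<notin> T \<longrightarrow> (x, y, True) \<in> set petersen_adj"
    by (simp add: petersen_edges_def petersen_adj_def T_def)
  then have B_edge: "(x, y, True) \<in> set petersen_adj"
    if "(x, y) \<in> set petersen_edges" "x \<notin> T" "y \<notin> T" for x y
    using that by auto
  have B_A: "(u, v, b) \<in> set petersen_adj \<or> (v, u, b) \<in> set petersen_adj"
    if "?A u v b" "u \<notin> T" "v \<notin> T" for u v b
  proof -
    have "b = True" "(u, v) \<in> set petersen_edges \<or> (v, u) \<in> set petersen_edges"
      using that(1) unfolding A by simp_all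
    then show ?thesis
      using B_edge that(2,3) by metis
  qed
  \<comment> \<open>The sign is \<open>False\<close> because two negative edges in series form a
    positive one.\<close>
  have "\<forall>(t, x)\<in>set sp. \<forall>(t', y)\<in>set sp. t = t' \<longrightarrow> x \<noteq> y \<longrightarrow>
      (x, y, False) \<in> set petersen_adj \<or> (y, x, False) \<in> set petersen_adj"
    by (simp add: petersen_adj_def sp_def)
  then have B_T: "(x, y, False) \<in> set petersen_adj \<or> (y, x, False) \<in> set petersen_adj"
    if "(t, x) \<in> set sp" "(t, y) \<in> set sp" "x \<noteq> y" for t x y
    using that by fast
  have A_sym: "?A v u b" if "?A u v b" for u v b
    using that unfolding A by blast
  have B: "(u, v, b) \<in> set petersen_adj \<or> (v, u, b) \<in> set petersen_adj" if uv: "?B u v b" for u v b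
  proof (cases "?A u v b")
    case True
    then show ?thesis
      using B_A uv unfolding suppress_def by blast
  next
    case False
    then obtain t b1 b2 where t: "u \<noteq> v" "t \<in> T" "?A u t b1" "?A t v b2" "b = (b1 \<noteq> b2)"
      using uv unfolding suppress_def by (elim conjE disjE bexE exE) auto
    then show ?thesis
      using A_T[OF A_sym[OF t(3)] t(2)] A_T[OF t(4,2)] B_T[of t u v] by simp
  qed
  show "\<not> odd_model (verts petersen_triangles) ?A 5 cl \<sigma>"
  proof
    assume m: "odd_model (verts petersen_triangles) ?A 5 cl \<sigma>"
    have m: "odd_model (verts petersen_triangles - T) ?B 5 cl \<sigma>"
    proof (rule odd_model_suppress[OF m])
      show "?A v u b" if "?A u v b" for u v b
        using that by (rule A_sym)
      show "u \<in> verts petersen_triangles" if "?A u v b" for u v b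
        using A_less[OF that] by simp
      show "v \<notin> T" if "t \<in> T" "?A t v b" for t v b
        using A_T[OF that(2,1)] by (auto simp: sp_def T_def)
      show "\<exists>N. finite N \<and> card N + 1 < 5 \<and> (\<forall>v b. ?A t v b \<longrightarrow> v \<in> N)" if "t \<in> T" for t
      proof (intro exI[of _ "snd ` set (filter (\<lambda>p. fst p = t) sp)"] conjI allI impI)
        show "card (snd ` set (filter (\<lambda>p. fst p = t) sp)) + 1 < 5"
          using that by (auto simp: sp_def T_def)
        show "v \<in> snd ` set (filter (\<lambda>p. fst p = t) sp)" if "?A t v b" for v b
          using A_T[OF that \<open>t \<in> T\<close>] by force
      qed simp
    qed
    define V :: "nat set" where "V = {0, 2, 3, 4, 5, 11, 12, 13, 14, 15}"
    have "\<forall>v<16. v \<notin> T \<longrightarrow> v \<in> V"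
      unfolding less_16_cases by (simp add: T_def V_def)
    then have V: "verts petersen_triangles - T = V"
      by (intro equalityI subsetI) (simp, auto simp: T_def V_def)
    note m = m[unfolded V]
    \<comment> \<open>Neighbourhoods without signs: the copies of a spoke count once, leaving three
      neighbours, fewer than the four that a singleton branch set requires.\<close>
    define N :: "nat \<Rightarrow> nat set" where
      "N v = {w. \<exists>b. (v, w, b) \<in> set petersen_adj \<or> (w, v, b) \<in> set petersen_adj}" for v
    have N: "N 0 = {2, 5, 15}" "N 2 = {0, 3, 13}" "N 3 = {2, 4, 11}" "N 4 = {3, 5, 14}"
        "N 5 = {0, 4, 12}" "N 11 = {3, 12, 15}" "N 12 = {5, 11, 13}" "N 13 = {2, 12, 14}"
        "N 14 = {4, 13, 15}" "N 15 = {0, 11, 14}"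
      unfolding N_def petersen_adj_def by auto
    have N_adj: "w \<in> N v" if "?B v w b" for v w b
      using B[OF that] unfolding N_def by blast
    have pm: "cl v < 5 \<and> (\<exists>w. ?B v w (\<sigma> v \<noteq> \<sigma> w) \<and> {u \<in> V. cl u = cl v} = {v, w})"
      if "v \<in> V" for v
    proof (rule odd_model_perfect_matching[OF m])
      show "w \<in> V" if "?B v w b" for v w b
        using B[OF that] unfolding petersen_adj_def V_def by auto
      show "\<not> ?B v v b" for v b
        using B[of v v b] unfolding petersen_adj_def by auto
      show "\<exists>M. finite M \<and> card M + 1 < 5 \<and> (\<forall>w b. ?B v w b \<longrightarrow> w \<in> M)" if "v \<in> V" for v
      proof (intro exI[of _ "N v"] conjI allI impI)
        show "finite (N v)" "card (N v) + 1 < 5"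
          using that by (auto simp: N V_def)
      qed (rule N_adj)
    qed (use that in \<open>simp_all add: V_def\<close>)
    have partner: "\<exists>w\<in>N v. \<forall>u\<in>V. cl u = cl v \<longleftrightarrow> u = v \<or> u = w" if v: "v \<in> V" for v
    proof -
      obtain w where w: "?B v w (\<sigma> v \<noteq> \<sigma> w)" "{u \<in> V. cl u = cl v} = {v, w}"
        using pm[OF v] by blast
      have "cl u = cl v \<longleftrightarrow> u = v \<or> u = w" if "u \<in> V" for u
        using w(2) that unfolding set_eq_iff by auto
      then show ?thesis
        using N_adj[OF w(1)] by blast
    qed
    \<comment> \<open>The last two assumptions forbid triangles and 4-cycles through
      \<open>uv\<close>, and can be computed from the table \<open>N\<close>.\<close>
    have sign: "?B u v ((cl u = cl v) = (\<sigma> u \<noteq> \<sigma> v))"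
      if "u \<in> V" "v \<in> V" "u \<noteq> v" "N u \<inter> N v = {}" "\<forall>w\<in>N u. w \<noteq> v \<longrightarrow> (\<forall>z\<in>N v. z \<noteq> u \<longrightarrow> z \<notin> N w)" for u v
    proof -
      note uv = that
      obtain w where w: "?B u w (\<sigma> u \<noteq> \<sigma> w)" "{x \<in> V. cl x = cl u} = {u, w}" "cl u < 5"
        using pm[OF uv(1)] by blast
      obtain z where z: "?B v z (\<sigma> v \<noteq> \<sigma> z)" "{x \<in> V. cl x = cl v} = {v, z}" "cl v < 5"
        using pm[OF uv(2)] by blast
      have N_sym: "x \<in> N y" if "y \<in> N x" for x y
        using that unfolding N_def by blast
      show ?thesis
      proof (rule odd_model_edge_sign[OF m w(3,2,1) z(3,2,1)])
        show "\<not> ?B w v b'" if "?B u w b" "w \<noteq> v" for w b b'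
          using N_adj[OF that(1)] N_adj[of w v b'] N_sym \<open>N u \<inter> N v = {}\<close> by blast
        show "\<not> ?B u z b'" if "?B v z b" "z \<noteq> u" for z b b'
          using N_adj[OF that(1)] N_adj[of u z b'] \<open>N u \<inter> N v = {}\<close> by blast
        show "\<not> ?B w z b''" if "?B u w b" "?B v z b'" "w \<noteq> v" "z \<noteq> u" for w z b b' b''
          using N_adj[OF that(1)] N_adj[OF that(2)] N_adj[of w z b''] that(3,4)
            \<open>\<forall>w\<in>N u. w \<noteq> v \<longrightarrow> (\<forall>z\<in>N v. z \<noteq> u \<longrightarrow> z \<notin> N w)\<close> by blast
      qed (rule \<open>u \<noteq> v\<close>)
    qed
    have "?B 0 2 ((cl 0 = cl 2) = (\<sigma> 0 \<noteq> \<sigma> 2))" "?B 2 3 ((cl 2 = cl 3) = (\<sigma> 2 \<noteq> \<sigma> 3))"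
        "?B 3 4 ((cl 3 = cl 4) = (\<sigma> 3 \<noteq> \<sigma> 4))" "?B 4 5 ((cl 4 = cl 5) = (\<sigma> 4 \<noteq> \<sigma> 5))"
        "?B 5 0 ((cl 5 = cl 0) = (\<sigma> 5 \<noteq> \<sigma> 0))"
      by (rule sign; simp add: N V_def)+
    note outer = this[THEN B]
    \<comment> \<open>Each outer edge has a single sign in \<open>petersen_adj\<close>:
      \<open>02\<close>, which replaces the path through \<open>1\<close>, is positive and the
      others are negative.\<close>
    have outer: "(cl 0 = cl 2) = (\<sigma> 0 = \<sigma> 2)" "(cl 2 = cl 3) = (\<sigma> 2 \<noteq> \<sigma> 3)"
        "(cl 3 = cl 4) = (\<sigma> 3 \<noteq> \<sigma> 4)" "(cl 4 = cl 5) = (\<sigma> 4 \<noteq> \<sigma> 5)"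
        "(cl 5 = cl 0) = (\<sigma> 5 \<noteq> \<sigma> 0)"
      using outer unfolding petersen_adj_def by simp_all
    have matched: "cl a = cl v \<and> cl b \<noteq> cl v \<and> cl c \<noteq> cl v \<or>
        cl a \<noteq> cl v \<and> cl b = cl v \<and> cl c \<noteq> cl v \<or>
        cl a \<noteq> cl v \<and> cl b \<noteq> cl v \<and> cl c = cl v"
      if "N v = {a, b, c}" "v \<in> V" "a \<in> V" "b \<in> V" "c \<in> V" "distinct [v, a, b, c]" for v a b c
    proof -
      note v = that
      obtain w where w: "w \<in> {a, b, c}" "\<forall>u\<in>V. cl u = cl v \<longleftrightarrow> u = v \<or> u = w"
        using partner[OF v(2)] unfolding v(1) by (elim bexE)
      show ?thesis
        using w(1) bspec[OF w(2) v(3)] bspec[OF w(2) v(4)] bspec[OF w(2) v(5)] v(6)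
        by auto
    qed
    note all = N[THEN matched, unfolded V_def, simplified]
    \<comment> \<open>Let the matching use \<open>k\<close> outer edges. After switching,
      \<open>5 - k\<close> outer edges are negative, and this number must be even, so
      \<open>k = 1\<close>. Then two inner vertices are left to be matched with each other, but
      their spokes end at adjacent outer vertices, so they are not adjacent.\<close>
    show False
      using outer all by argo
  qed
qed

theorem theorem1p5:
  "\<exists>G :: (nat, nat) mgraph.
     fin_mgraph G \<and> k_connected 2 G \<and> eulerian G \<and> loopless G \<and>
     odd_minor_free (complete_graph 5) G \<and> even (card (edges G)) \<and>
     \<not> even_cycle_decomposable G"
proof (intro exI conjI)
  show "fin_mgraph petersen_triangles"
    by (rule fin_mgraph_list_graph) (simp add: petersen_edges_def)
  show "loopless petersen_triangles"
    by (rule loopless_list_graph[OF petersen_loopless])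
  show "even (card (edges petersen_triangles))"
    by (simp add: petersen_edges_def)
qed (fact petersen_k_connected petersen_eulerian petersen_odd_minor_free
    petersen_not_even_cycle_decomposable)+

end
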